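(* Let $f_1,\dots,f_m$ be rational linear forms on $\mathbb{R}^d$ of weight zero, i.e. $f_i(1,1,\dots,1)=0$ for all $i$; let $s := \{x : f_1(x)=\cdots=f_m(x)=0\}$, $P:=[0,1]^d\cap s$, and $\mathcal{H} := \{h_{jk}\cap s : 1\le j<k\le d,\ h_{jk}\not\supseteq s\}$ where $h_{jk}$ is the hyperplane $x_j=x_k$. Assume a magic labelling exists, i.e. $s$ contains an integer point with distinct positive coordinates. Let $B^\circ(t)$ be the number of integer points $x\in s$ with distinct entries and $0<x_i<t$, and $B(t)$ the number of pairs $(x,\sigma)$ with $x\in s\cap\mathbb{Z}^d$, $0\le x_i\le t$, and $\sigma$ a permutation of $[d]$ compatible with $x$ and realizable in $s$. Then $$B^\circ(t) = \sum_{u\in\mathcal{L}(P^\circ,\mathcal{H})}\mu(\hat 0,u)\,E_{(0,1)^d\cap u}(t),\qquad B(t)=\sum_{u\in\mathcal{L}(P^\circ,\mathcal{H})}|\mu(\hat 0,u)|\,E_{[0,1]^d\cap u}(t),$$ where $\mu$ is the Möbius function of $\mathcal{L}(P^\circ,\mathcal{H})$.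
   Context: $\mathcal{L}(P^\circ,\mathcal{H}) := \{P^\circ\cap\bigcap\mathcal{S} : \mathcal{S}\subseteq\mathcal{H}\}\setminus\{\emptyset\}$, ordered by reverse inclusion, with bottom element $\hat 0 = P^\circ$ (the relative interior of $P$). For a member $u$, $E_{Q\cap u}(t)$ denotes the number of integer points in $t(Q\cap \bar u)$, where $\bar u = \bigcap\mathcal S$ is the flat (affine span of $u$) whose intersection with $P^\circ$ is $u$. The Möbius function is $\mu(r,r)=1$, $\mu(r,s)=-\sum_{r\le w<s}\mu(r,w)$ for $r<s$, and $0$ otherwise. A point $x$ with distinct coordinates realizes the permutation $\tau$ if $x_{\tau1}<\cdots<x_{\tau d}$; realizable in $s$ means realized by some point of $s$; $x$ and $\sigma$ are compatible if $x_{\sigma1}\le\cdots\le x_{\sigma d}$. *)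

theory Defs
  imports "HOL-Analysis.Analysis"
begin

text \<open>The coordinate set $[d]$ is a finite linearly ordered type \<open>'d\<close>; the order is what
  gives meaning to $x_{\tau 1} < \dots < x_{\tau d}$.\<close>

definition rational_linear_form :: "(real ^ 'd \<Rightarrow> real) \<Rightarrow> bool" where
  "rational_linear_form f \<longleftrightarrow> linear f \<and> (\<forall>j. f (axis j 1) \<in> \<rat>)"

definition weight_zero :: "(real ^ 'd \<Rightarrow> real) \<Rightarrow> bool" where
  "weight_zero f \<longleftrightarrow> f (\<chi> j. 1) = 0"

definition integer_points :: "(real ^ 'd) set" where
  "integer_points = {x. \<forall>i. x $ i \<in> \<int>}"

definition distinct_coords :: "real ^ 'd \<Rightarrow> bool" where
  "distinct_coords x \<longleftrightarrow> inj (\<lambda>i. x $ i)"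

definition closed_cube :: "(real ^ 'd) set" where
  "closed_cube = {x. \<forall>i. 0 \<le> x $ i \<and> x $ i \<le> 1}"

definition open_cube :: "(real ^ 'd) set" where
  "open_cube = {x. \<forall>i. 0 < x $ i \<and> x $ i < 1}"

definition hyp :: "'d \<Rightarrow> 'd \<Rightarrow> (real ^ 'd) set" where
  "hyp j k = {x. x $ j = x $ k}"

definition induced_arrangement ::
  "(real ^ 'd::{finite,linorder}) set \<Rightarrow> (real ^ 'd::{finite,linorder}) set set" where
  "induced_arrangement s = {hyp j k \<inter> s | j k. j < k \<and> \<not> s \<subseteq> hyp j k}"

definition intersection_poset :: "'a set \<Rightarrow> 'a set set \<Rightarrow> 'a set set" where
  "intersection_poset U \<H> = {U \<inter> \<Inter>\<S> | \<S>. \<S> \<subseteq> \<H>} - {{}}"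

text \<open>The Moebius function $\mu(r,v)$ of a finite family of sets \<open>L\<close> ordered by
  \<^emph>\<open>reverse\<close> inclusion: $r \le w < v$ means \<open>w \<subseteq> r\<close> and \<open>v \<subset> w\<close>. The finiteness
  test only serves termination.\<close>

function moebius_fun :: "'a set set \<Rightarrow> 'a set \<Rightarrow> 'a set \<Rightarrow> int" where
  "moebius_fun L r v =
    (if r = v then 1
     else if finite L \<and> v \<subset> r then - (\<Sum>w \<in> {w \<in> L. w \<subseteq> r \<and> v \<subset> w}. moebius_fun L r w)
     else 0)"
  by pat_completeness auto

termination
proof (relation "Wellfounded.measure (\<lambda>(L, r, v). card {w \<in> L. v \<subset> w})")
  fix L :: "'a set set" and r v w
  assume "finite L \<and> v \<subset> r" and w: "w \<in> {w \<in> L. w \<subseteq> r \<and> v \<subset> w}"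
  moreover from w have "{x \<in> L. w \<subset> x} \<subset> {x \<in> L. v \<subset> x}" by blast
  ultimately show "((L, r, w), (L, r, v)) \<in> Wellfounded.measure (\<lambda>(L, r, v). card {w \<in> L. v \<subset> w})"
    by (simp add: psubset_card_mono)
qed simp

declare moebius_fun.simps [simp del]

definition ehrhart :: "(real ^ 'd) set \<Rightarrow> nat \<Rightarrow> nat" where
  "ehrhart X t = card (integer_points \<inter> (\<lambda>x. real t *\<^sub>R x) ` X)"

text \<open>$E_{Q \cap u}(t)$, with $u$ replaced by the flat it spans. The affine hull is used because
  \<open>\<Inter>\<S>\<close> is not the flat when \<open>\<S> = {}\<close>: the flat of the bottom element is $s$, not the whole space.\<close>

definition flat_ehrhart :: "(real ^ 'd) set \<Rightarrow> (real ^ 'd) set \<Rightarrow> nat \<Rightarrow> nat" where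
  "flat_ehrhart Q u t = ehrhart (Q \<inter> affine hull u) t"

definition realizes ::
  "real ^ 'd::{finite,linorder} \<Rightarrow> ('d::{finite,linorder} \<Rightarrow> 'd) \<Rightarrow> bool" where
  "realizes x \<tau> \<longleftrightarrow> distinct_coords x \<and> (\<forall>i j. i < j \<longrightarrow> x $ \<tau> i < x $ \<tau> j)"

definition realizable_in ::
  "('d::{finite,linorder} \<Rightarrow> 'd) \<Rightarrow> (real ^ 'd::{finite,linorder}) set \<Rightarrow> bool" where
  "realizable_in \<tau> s \<longleftrightarrow> (\<exists>x\<in>s. realizes x \<tau>)"

definition compatible ::
  "real ^ 'd::{finite,linorder} \<Rightarrow> ('d::{finite,linorder} \<Rightarrow> 'd) \<Rightarrow> bool" where
  "compatible x \<sigma> \<longleftrightarrow> (\<forall>i j. i \<le> j \<longrightarrow> x $ \<sigma> i \<le> x $ \<sigma> j)"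

definition open_count :: "(real ^ 'd) set \<Rightarrow> nat \<Rightarrow> nat" where
  "open_count s t =
    card {x \<in> s \<inter> integer_points. distinct_coords x \<and> (\<forall>i. 0 < x $ i \<and> x $ i < real t)}"

definition closed_count :: "(real ^ 'd::{finite,linorder}) set \<Rightarrow> nat \<Rightarrow> nat" where
  "closed_count s t =
    card {(x, \<sigma>). x \<in> s \<inter> integer_points \<and> (\<forall>i. 0 \<le> x $ i \<and> x $ i \<le> real t) \<and>
                  \<sigma> permutes UNIV \<and> compatible x \<sigma> \<and> realizable_in \<sigma> s}"

end

theory Submission
  imports Defs
begin

text \<open>All flats pass through the centre of the cube, so \<open>L\<close> is isomorphic to the lattice of flats
  of the central arrangement induced on \<open>s\<close>. Whitney's formula writes \<open>\<mu>(0,u)\<close> as the sum of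
  \<open>(-1)\<^bsup>|B|\<^esup>\<close> over the sets \<open>B\<close> of hyperplanes that cut out \<open>u\<close>. Exchanging summations, the
  weights of the flats through a point \<open>x\<close> add up to a sum over all sets of hyperplanes through \<open>x\<close>.
  The signed sum is \<open>1\<close> or \<open>0\<close> according to whether \<open>x\<close> avoids the arrangement. The sign of
  \<open>\<mu>(0,u)\<close> is \<open>(-1)\<close> to the codimension of \<open>u\<close>, so by Zaslavsky's theorem the unsigned sum counts
  the chambers of the arrangement of hyperplanes through \<open>x\<close>. These correspond to the realizable
  permutations compatible with \<open>x\<close>: move \<open>x\<close> slightly into the chamber.\<close>

subsection \<open>Chambers of a central arrangement\<close>

text \<open>Chambers are encoded by the set of indices whose linear form is positive on them.\<close>

definition patterns :: "'a::euclidean_space set \<Rightarrow> ('i \<Rightarrow> 'a) \<Rightarrow> 'i set \<Rightarrow> 'i set set" where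
  "patterns V a I = (\<lambda>x. {i\<in>I. 0 < a i \<bullet> x}) ` {x\<in>V. \<forall>i\<in>I. a i \<bullet> x \<noteq> 0}"

text \<open>Flats are named by index sets, so different \<open>B\<close> may name the same subspace.
  Keeping \<open>V\<close> as a parameter makes the restriction to a hyperplane a mere change of
  \<open>V\<close>.\<close>

definition flat :: "'a::euclidean_space set \<Rightarrow> ('i \<Rightarrow> 'a) \<Rightarrow> 'i set \<Rightarrow> 'a set" where
  "flat V a B = {x\<in>V. \<forall>i\<in>B. a i \<bullet> x = 0}"

lemma flat_empty [simp]: "flat V a {} = V"
  by (auto simp: flat_def)

lemma flat_insert: "flat V a (insert h B) = flat (V \<inter> {x. a h \<bullet> x = 0}) a B"
  by (auto simp: flat_def)

lemma subspace_flat: "subspace V \<Longrightarrow> subspace (flat V a B)"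
  by (auto simp: flat_def subspace_def inner_add_right)

lemma subspace_Int_hyperplane: "subspace V \<Longrightarrow> subspace (V \<inter> {x. (a::'a::euclidean_space) \<bullet> x = 0})"
  by (simp add: subspace_inter subspace_hyperplane)

text \<open>The drop by exactly one is what flips the sign of \<open>(-1) ^ dim V\<close> in the two
  deletion-restriction inductions below.\<close>

lemma dim_Int_hyperplane:
  fixes a :: "'a::euclidean_space"
  assumes "subspace V" "\<not> V \<subseteq> {x. a \<bullet> x = 0}"
  shows "dim V = Suc (dim (V \<inter> {x. a \<bullet> x = 0}))"
proof -
  have "0 \<in> V \<inter> {x. a \<bullet> x = 0}"
    using assms(1) subspace_0 by auto
  then have "aff_dim (V \<inter> {x. a \<bullet> x = 0}) = aff_dim V - 1"
    using aff_dim_affine_Int_hyperplane[OF subspace_imp_affine[OF assms(1)], of a 0] assms(2) by auto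
  then show ?thesis
    using assms(1) by (simp add: aff_dim_subspace subspace_Int_hyperplane)
qed

lemma sum_Pow_insert:
  fixes g :: "'i set \<Rightarrow> 'b::comm_monoid_add"
  assumes "finite J" "h \<notin> J"
  shows "sum g (Pow (insert h J)) = (\<Sum>B\<in>Pow J. g B) + (\<Sum>B\<in>Pow J. g (insert h B))"
proof -
  have "inj_on (insert h) (Pow J)"
    using assms(2) by (auto simp: inj_on_def)
  moreover have "Pow J \<inter> insert h ` Pow J = {}"
    using assms(2) by auto
  ultimately show ?thesis
    using assms(1) by (simp add: Pow_insert sum.union_disjoint sum.reindex)
qed

text \<open>Pairing \<open>B\<close> with \<open>insert h B\<close> cancels all terms as soon as
  there is an index \<open>h\<close>.\<close>

lemma sum_Pow_minus_one_power:
  assumes "finite I"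
  shows "(\<Sum>B\<in>Pow I. (-1::int) ^ card B) = (if I = {} then 1 else 0)"
  using assms
proof (induction I rule: finite_induct)
  case (insert h J)
  have "(\<Sum>B\<in>Pow J. (-1::int) ^ card (insert h B)) = (\<Sum>B\<in>Pow J. - ((-1) ^ card B))"
  proof (rule sum.cong)
    fix B assume "B \<in> Pow J"
    then have "finite B" "h \<notin> B"
      using insert.hyps finite_subset by auto
    then show "(-1::int) ^ card (insert h B) = - ((-1) ^ card B)" by simp
  qed simp
  then show ?case
    using insert.hyps by (simp add: sum_Pow_insert sum_negf)
qed simp

text \<open>Each form is continuous along the ray, so a strict sign persists for all small
  \<open>e\<close>, and finitely many such conditions hold at once. This serves to push a point off
  a hyperplane and, later, to break the ties of a lattice point without disturbing its other
  comparisons.\<close>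

lemma exists_small_perturbation:
  fixes a :: "'i \<Rightarrow> 'a::euclidean_space"
  assumes "finite J" "\<And>i. i \<in> J \<Longrightarrow> a i \<bullet> z \<noteq> 0"
  shows "\<exists>e>0. \<forall>i\<in>J. sgn (a i \<bullet> (z + e *\<^sub>R v)) = sgn (a i \<bullet> z)"
proof -
  have "\<forall>\<^sub>F e in at_right (0::real). sgn (a i \<bullet> (z + e *\<^sub>R v)) = sgn (a i \<bullet> z)" if "i \<in> J" for i
  proof -
    have lim: "((\<lambda>e::real. a i \<bullet> (z + e *\<^sub>R v)) \<longlongrightarrow> a i \<bullet> (z + 0 *\<^sub>R v)) (at_right 0)"
      by (intro tendsto_intros)
    show ?thesis
    proof (cases "0 < a i \<bullet> z")
      case True
      then have "\<forall>\<^sub>F e in at_right (0::real). 0 < a i \<bullet> (z + e *\<^sub>R v)"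
        using order_tendstoD(1)[OF lim, of 0] by simp
      then show ?thesis
        by eventually_elim (use True in simp)
    next
      case False
      then have neg: "a i \<bullet> z < 0"
        using assms(2)[OF that] by linarith
      then have "\<forall>\<^sub>F e in at_right (0::real). a i \<bullet> (z + e *\<^sub>R v) < 0"
        using order_tendstoD(2)[OF lim, of 0] by simp
      then show ?thesis
        by eventually_elim (use neg in simp)
    qed
  qed
  then have "\<forall>\<^sub>F e in at_right (0::real). \<forall>i\<in>J. sgn (a i \<bullet> (z + e *\<^sub>R v)) = sgn (a i \<bullet> z)"
    using assms(1) by (simp add: eventually_ball_finite)
  then have "\<forall>\<^sub>F e in at_right (0::real). 0 < e \<and> (\<forall>i\<in>J. sgn (a i \<bullet> (z + e *\<^sub>R v)) = sgn (a i \<bullet> z))"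
    using eventually_at_right_less[of "0::real"] by eventually_elim auto
  then show ?thesis
    using eventually_happens by (fastforce simp: trivial_limit_at_right_real)
qed

lemma sgn_eq_imp:
  fixes u v :: real
  assumes "sgn u = sgn v"
  shows "u = 0 \<longleftrightarrow> v = 0" "0 < u \<longleftrightarrow> 0 < v"
  using assms by (auto simp: sgn_if split: if_splits)

lemma finite_patterns: "finite I \<Longrightarrow> finite (patterns V a I)"
  by (rule finite_subset[of _ "Pow I"]) (auto simp: patterns_def)

text \<open>Deletion and restriction: a chamber of the arrangement without the hyperplane \<open>h\<close> is cut
  in two exactly if it meets \<open>h\<close>, and then it meets \<open>h\<close> in a single chamber of the restriction.\<close>

lemma card_patterns_insert:
  fixes a :: "'i \<Rightarrow> 'a::euclidean_space"
  assumes "finite J" "h \<notin> J" "subspace V" "\<not> V \<subseteq> {x. a h \<bullet> x = 0}"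
  shows "card (patterns V a (insert h J)) =
    card (patterns V a J) + card (patterns (V \<inter> {x. a h \<bullet> x = 0}) a J)"
proof -
  define p where "p = (\<lambda>x. {i\<in>J. 0 < a i \<bullet> x})"
  define X where "X = {x\<in>V. \<forall>i\<in>J. a i \<bullet> x \<noteq> 0}"
  \<comment> \<open>Chambers of the deletion that meet the open positive, respectively negative,
    side of \<open>h\<close>. They are named by the forms in \<open>J\<close> alone, so one chamber
    may occur in both sets.\<close>
  define Sp where "Sp = p ` {x\<in>X. 0 < a h \<bullet> x}"
  define Sn where "Sn = p ` {x\<in>X. a h \<bullet> x < 0}"
  obtain v0 where v0: "v0 \<in> V" "a h \<bullet> v0 \<noteq> 0"
    using assms(4) by auto
  obtain v where v: "v \<in> V" "0 < a h \<bullet> v"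
  proof (cases "0 < a h \<bullet> v0")
    case False
    then show ?thesis
      using that[of "-v0"] v0 assms(3) by (auto simp: subspace_neg)
  qed (use that v0 in auto)
  \<comment> \<open>A chamber of the deletion is relatively open in \<open>V\<close>, so from a
    point of it on \<open>h\<close> one can move along \<open>v\<close> and along \<open>-v\<close>
    to either side without leaving it.\<close>
  have push: "p x \<in> Sp \<and> p x \<in> Sn" if x: "x \<in> X" and hx: "a h \<bullet> x = 0" for x
  proof -
    have nz: "a i \<bullet> x \<noteq> 0" if "i \<in> J" for i
      using x that by (auto simp: X_def)
    obtain e where e: "e > 0" "\<forall>i\<in>J. sgn (a i \<bullet> (x + e *\<^sub>R v)) = sgn (a i \<bullet> x)"
      using exists_small_perturbation[where a=a, OF assms(1) nz] by blast
    obtain d where d: "d > 0" "\<forall>i\<in>J. sgn (a i \<bullet> (x + d *\<^sub>R (-v))) = sgn (a i \<bullet> x)"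
      using exists_small_perturbation[where a=a, OF assms(1) nz] by blast
    have inV: "x + c *\<^sub>R v \<in> V" "x + c *\<^sub>R (-v) \<in> V" for c
      using x v assms(3) by (auto simp: X_def intro!: subspace_add subspace_diff subspace_scale)
    have "x + e *\<^sub>R v \<in> X" "p (x + e *\<^sub>R v) = p x"
      using e inV(1)[of e] nz sgn_eq_imp unfolding X_def p_def by blast+
    moreover have "0 < a h \<bullet> (x + e *\<^sub>R v)"
      using e v hx by (simp add: inner_add_right)
    moreover have "x + d *\<^sub>R (-v) \<in> X" "p (x + d *\<^sub>R (-v)) = p x"
      using d inV(2)[of d] nz sgn_eq_imp unfolding X_def p_def by blast+
    moreover have "a h \<bullet> (x + d *\<^sub>R (-v)) < 0"
      using d v hx by (simp add: inner_diff_right)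
    ultimately show ?thesis
      unfolding Sp_def Sn_def by (metis (mono_tags, lifting) image_eqI mem_Collect_eq)
  qed
  have un: "Sp \<union> Sn = patterns V a J"
  proof
    show "Sp \<union> Sn \<subseteq> patterns V a J"
      by (auto simp: Sp_def Sn_def p_def X_def patterns_def)
    have "p x \<in> Sp \<union> Sn" if "x \<in> X" for x
      using push[OF that] that by (cases "a h \<bullet> x" "0::real" rule: linorder_cases) (auto simp: Sp_def Sn_def)
    then show "patterns V a J \<subseteq> Sp \<union> Sn"
      by (auto simp: p_def X_def patterns_def)
  qed
  have int: "Sp \<inter> Sn = patterns (V \<inter> {x. a h \<bullet> x = 0}) a J"
  proof
    show "patterns (V \<inter> {x. a h \<bullet> x = 0}) a J \<subseteq> Sp \<inter> Sn"
      using push by (auto simp: p_def X_def patterns_def)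
    show "Sp \<inter> Sn \<subseteq> patterns (V \<inter> {x. a h \<bullet> x = 0}) a J"
    proof
      fix T assume "T \<in> Sp \<inter> Sn"
      then obtain x y where x: "x \<in> X" "0 < a h \<bullet> x" "T = p x" and y: "y \<in> X" "a h \<bullet> y < 0" "T = p y"
        by (auto simp: Sp_def Sn_def)
      \<comment> \<open>Up to a positive factor, the point where the segment from \<open>x\<close>
        to \<open>y\<close> crosses \<open>h\<close>. Both coefficients are positive, so a form with
        the same sign at \<open>x\<close> and \<open>y\<close> keeps that sign at
        \<open>z\<close>.\<close>
      define z where "z = (- (a h \<bullet> y)) *\<^sub>R x + (a h \<bullet> x) *\<^sub>R y"
      have z: "z \<in> V \<inter> {x. a h \<bullet> x = 0}"
        using x y assms(3)
        by (auto simp: z_def X_def inner_add_right inner_diff_right intro!: subspace_add subspace_diff subspace_scale subspace_neg)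
      have "a i \<bullet> z \<noteq> 0 \<and> (0 < a i \<bullet> z \<longleftrightarrow> 0 < a i \<bullet> x)" if i: "i \<in> J" for i
      proof -
        have eq: "a i \<bullet> z = (- (a h \<bullet> y)) * (a i \<bullet> x) + (a h \<bullet> x) * (a i \<bullet> y)"
          by (simp add: z_def inner_add_right inner_diff_right)
        have sg: "0 < a i \<bullet> x \<longleftrightarrow> 0 < a i \<bullet> y"
          using x(3) y(3) i by (auto simp: p_def)
        have nz: "a i \<bullet> x \<noteq> 0" "a i \<bullet> y \<noteq> 0"
          using x y i by (auto simp: X_def)
        show ?thesis
        proof (cases "0 < a i \<bullet> x")
          case True
          then have "0 < (- (a h \<bullet> y)) * (a i \<bullet> x)" "0 < (a h \<bullet> x) * (a i \<bullet> y)"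
            using sg x(2) y(2) by (simp_all add: mult_neg_pos)
          then show ?thesis using True eq by linarith
        next
          case False
          then have "a i \<bullet> x < 0" "a i \<bullet> y < 0" using sg nz by linarith+
          then have "(- (a h \<bullet> y)) * (a i \<bullet> x) < 0" "(a h \<bullet> x) * (a i \<bullet> y) < 0"
            using x(2) y(2) by (simp_all add: mult_pos_neg mult_neg_neg)
          then show ?thesis using False eq by linarith
        qed
      qed
      then have "z \<in> {x \<in> V \<inter> {x. a h \<bullet> x = 0}. \<forall>i\<in>J. a i \<bullet> x \<noteq> 0}" "T = {i\<in>J. 0 < a i \<bullet> z}"
        using z x(3) by (auto simp: p_def)
      then show "T \<in> patterns (V \<inter> {x. a h \<bullet> x = 0}) a J"
        unfolding patterns_def by blast
    qed
  qed
  have fin: "finite Sp" "finite Sn"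
    using un finite_patterns[OF assms(1), of V a] by (metis finite_Un)+
  \<comment> \<open>The index \<open>h\<close> occurs in no member of \<open>Sp\<close> or
    \<open>Sn\<close>, so inserting it marks the positive halves and the union is disjoint.\<close>
  have split: "patterns V a (insert h J) = insert h ` Sp \<union> Sn"
  proof
    have "{i\<in>insert h J. 0 < a i \<bullet> x} \<in> insert h ` Sp \<union> Sn" if "x \<in> V" "\<forall>i\<in>insert h J. a i \<bullet> x \<noteq> 0" for x
    proof (cases "0 < a h \<bullet> x")
      case True
      then have "{i\<in>insert h J. 0 < a i \<bullet> x} = insert h (p x)" by (auto simp: p_def)
      moreover have "p x \<in> Sp" using True that by (auto simp: Sp_def X_def)
      ultimately show ?thesis by simp
    next
      case False
      then have "{i\<in>insert h J. 0 < a i \<bullet> x} = p x" by (auto simp: p_def)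
      moreover have "p x \<in> Sn" using False that by (auto simp: Sn_def X_def less_le)
      ultimately show ?thesis by simp
    qed
    then show "patterns V a (insert h J) \<subseteq> insert h ` Sp \<union> Sn"
      unfolding patterns_def by (intro image_subsetI) simp
    have "insert h (p x) \<in> patterns V a (insert h J)" if "x \<in> X" "0 < a h \<bullet> x" for x
      unfolding patterns_def using that by (intro image_eqI[of _ _ x]) (auto simp: p_def X_def)
    moreover have "p x \<in> patterns V a (insert h J)" if "x \<in> X" "a h \<bullet> x < 0" for x
      unfolding patterns_def using that by (intro image_eqI[of _ _ x]) (auto simp: p_def X_def)
    ultimately show "insert h ` Sp \<union> Sn \<subseteq> patterns V a (insert h J)"
      by (auto simp: Sp_def Sn_def)
  qed
  have nh: "h \<notin> T" if "T \<in> Sp \<union> Sn" for T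
    using that assms(2) by (auto simp: Sp_def Sn_def p_def)
  have "inj_on (insert h) Sp"
    by (rule inj_onI) (metis UnI1 insert_ident nh)
  moreover have "insert h ` Sp \<inter> Sn = {}"
    using nh by blast
  ultimately have "card (patterns V a (insert h J)) = card Sp + card Sn"
    using fin by (simp add: split card_Un_disjoint card_image)
  then show ?thesis
    using card_Un_Int[OF fin] by (simp add: un int)
qed

text \<open>Zaslavsky's theorem, with Whitney's expansion in place of the characteristic polynomial.
  Vanishing normals are allowed, so that the restriction needs no special treatment: they make
  both sides zero.\<close>

theorem card_patterns:
  fixes a :: "'i \<Rightarrow> 'a::euclidean_space"
  assumes "finite I" "subspace V"
  shows "int (card (patterns V a I)) = (\<Sum>B\<in>Pow I. (-1) ^ (card B + dim V + dim (flat V a B)))"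
  using assms
proof (induction I arbitrary: V rule: finite_induct)
  case empty
  then have "patterns V a {} = {{}}"
    using subspace_0 by (auto simp: patterns_def)
  then show ?case by simp
next
  case (insert h J)
  let ?W = "V \<inter> {x. a h \<bullet> x = 0}"
  have cd: "card (insert h B) = Suc (card B)" if "B \<in> Pow J" for B
  proof -
    have "finite B" "h \<notin> B"
      using insert.hyps that finite_subset by auto
    then show ?thesis by simp
  qed
  show ?case
  proof (cases "V \<subseteq> {x. a h \<bullet> x = 0}")
    case True
    then have "patterns V a (insert h J) = {}"
      by (auto simp: patterns_def)
    moreover have "?W = V" using True by blast
    then have "(\<Sum>B\<in>Pow J. (-1) ^ (card (insert h B) + dim V + dim (flat V a (insert h B)))) =
        (\<Sum>B\<in>Pow J. - ((-1::int) ^ (card B + dim V + dim (flat V a B))))"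
      by (intro sum.cong) (simp_all add: cd flat_insert)
    ultimately show ?thesis
      using insert.hyps by (simp add: sum_Pow_insert sum_negf)
  next
    case False
    \<comment> \<open>The additional element of \<open>insert h B\<close> and the additional
      dimension of \<open>V\<close> over \<open>?W\<close> each flip the sign, so these terms are
      the expansion for \<open>?W\<close>.\<close>
    have "(\<Sum>B\<in>Pow J. (-1) ^ (card (insert h B) + dim V + dim (flat V a (insert h B)))) =
        (\<Sum>B\<in>Pow J. (-1::int) ^ (card B + dim ?W + dim (flat ?W a B)))"
      by (intro sum.cong) (simp_all add: cd flat_insert dim_Int_hyperplane[OF insert.prems False])
    then show ?thesis
      using insert.hyps insert.IH[OF insert.prems] insert.IH[OF subspace_Int_hyperplane[OF insert.prems]]
        card_patterns_insert[where a=a, OF insert.hyps insert.prems False]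
      by (simp add: sum_Pow_insert)
  qed
qed

text \<open>The sum is that of the deletion minus that of the restriction, and the restriction has
  one dimension less, so both contributions carry the same sign. This later gives the sign of the
  Moebius function.\<close>

lemma Whitney_sum_sign:
  fixes a :: "'i \<Rightarrow> 'a::euclidean_space"
  assumes "finite I" "subspace V"
  shows "0 \<le> (-1) ^ (dim V + dim F) * (\<Sum>B\<in>Pow I. if flat V a B = F then (-1::int) ^ card B else 0)"
  using assms
proof (induction I arbitrary: V rule: finite_induct)
  case empty
  then show ?case by (cases "V = F") simp_all
next
  case (insert h J)
  let ?W = "V \<inter> {x. a h \<bullet> x = 0}"
  let ?\<nu> = "\<lambda>V. \<Sum>B\<in>Pow J. if flat V a B = F then (-1::int) ^ card B else 0"
  have "(\<Sum>B\<in>Pow J. if flat V a (insert h B) = F then (-1::int) ^ card (insert h B) else 0) =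
      (\<Sum>B\<in>Pow J. - (if flat ?W a B = F then (-1::int) ^ card B else 0))"
  proof (rule sum.cong)
    fix B assume "B \<in> Pow J"
    then have "finite B" "h \<notin> B"
      using insert.hyps finite_subset by auto
    then show "(if flat V a (insert h B) = F then (-1::int) ^ card (insert h B) else 0) =
        - (if flat ?W a B = F then (-1::int) ^ card B else 0)"
      by (simp add: flat_insert)
  qed simp
  then have eq: "(\<Sum>B\<in>Pow (insert h J). if flat V a B = F then (-1::int) ^ card B else 0) = ?\<nu> V - ?\<nu> ?W"
    using insert.hyps by (simp add: sum_Pow_insert sum_negf)
  show ?case
  proof (cases "V \<subseteq> {x. a h \<bullet> x = 0}")
    case True
    \<comment> \<open>Deletion and restriction coincide, so the sum is zero.\<close>
    then have "?W = V" by blast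
    then show ?thesis by (simp add: eq)
  next
    case False
    have "0 \<le> (-1) ^ (dim V + dim F) * ?\<nu> V" "0 \<le> (-1) ^ (dim ?W + dim F) * ?\<nu> ?W"
      using insert.IH insert.prems subspace_Int_hyperplane by blast+
    then show ?thesis
      unfolding eq by (simp add: dim_Int_hyperplane[OF insert.prems False] right_diff_distrib)
  qed
qed

subsection \<open>Whitney's formula for the Moebius function\<close>

text \<open>The interval sums form a triangular system whose only solution is the Moebius function.
  The induction runs on the number of members strictly containing \<open>v\<close>, that is,
  strictly before it in the order.\<close>

lemma moebius_fun_eqI:
  assumes "finite L" and "\<And>w. w \<in> L \<Longrightarrow> w \<subseteq> r"
    and sum: "\<And>v. v \<in> L \<Longrightarrow> (\<Sum>w\<in>{w\<in>L. v \<subseteq> w}. g w) = (if v = r then 1 else 0)"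
    and "v \<in> L"
  shows "moebius_fun L r v = g v"
  using \<open>v \<in> L\<close>
proof (induction "card {w\<in>L. v \<subset> w}" arbitrary: v rule: less_induct)
  case less
  have "{w\<in>L. v \<subseteq> w} = insert v {w\<in>L. v \<subset> w}"
    using less.prems by auto
  then have g: "g v + (\<Sum>w\<in>{w\<in>L. v \<subset> w}. g w) = (if v = r then 1 else 0)"
    using sum[OF less.prems] assms(1) by simp
  show ?case
  proof (cases "v = r")
    case True
    have "{w\<in>L. v \<subset> w} = {}" using True assms(2) by blast
    then have "g v = 1" using g True by (simp only: sum.empty) simp
    then show ?thesis using True by (simp add: moebius_fun.simps)
  next
    case False
    have "moebius_fun L r w = g w" if w: "w \<in> {w\<in>L. v \<subset> w}" for w
    proof (rule less.hyps)
      have "{x\<in>L. w \<subset> x} \<subset> {x\<in>L. v \<subset> x}" using w by blast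
      then show "card {x\<in>L. w \<subset> x} < card {x\<in>L. v \<subset> x}"
        using assms(1) by (simp add: psubset_card_mono)
    qed (use w in simp)
    moreover have "{w\<in>L. w \<subseteq> r \<and> v \<subset> w} = {w\<in>L. v \<subset> w}"
      using assms(2) by blast
    moreover have "v \<subset> r" using False assms(2) less.prems by blast
    ultimately have "moebius_fun L r v = - (\<Sum>w\<in>{w\<in>L. v \<subset> w}. g w)"
      using False assms(1) by (simp add: moebius_fun.simps[of L r v])
    then show ?thesis using g False by simp
  qed
qed

text \<open>Summed over the members containing \<open>v\<close>, the right-hand side runs over all
  sets of hyperplanes through \<open>v\<close>. This alternating sum vanishes unless there are no
  such hyperplanes, which means \<open>v = U\<close>. The family \<open>h\<close> may have
  repetitions.\<close>

lemma moebius_fun_Whitney: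
  assumes "finite I" and "\<And>i. i \<in> I \<Longrightarrow> \<not> U \<subseteq> h i"
    and L: "L = (\<lambda>B. U \<inter> (\<Inter>i\<in>B. h i)) ` Pow I" and "v \<in> L"
  shows "moebius_fun L U v = (\<Sum>B\<in>Pow I. if U \<inter> (\<Inter>i\<in>B. h i) = v then (-1) ^ card B else 0)"
proof (rule moebius_fun_eqI[where g="\<lambda>v. \<Sum>B\<in>Pow I. if U \<inter> (\<Inter>i\<in>B. h i) = v then (-1) ^ card B else 0"])
  show "finite L" using assms(1) L by simp
  show "w \<subseteq> U" if "w \<in> L" for w using that L by auto
  fix v assume v: "v \<in> L"
  let ?c = "\<lambda>B. U \<inter> (\<Inter>i\<in>B. h i)"
  have "v \<subseteq> U" using v L by auto
  have "(\<Sum>w\<in>{w\<in>L. v \<subseteq> w}. \<Sum>B\<in>Pow I. if ?c B = w then (-1) ^ card B else (0::int)) =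
      (\<Sum>B\<in>Pow I. \<Sum>w\<in>{w\<in>L. v \<subseteq> w}. if ?c B = w then (-1) ^ card B else 0)"
    by (rule sum.swap)
  \<comment> \<open>Each \<open>?c B\<close> lies in \<open>L\<close>, so at most one term of the
    inner sum survives, the one with \<open>w = ?c B\<close>.\<close>
  also have "\<dots> = (\<Sum>B\<in>Pow I. if v \<subseteq> ?c B then (-1) ^ card B else 0)"
    using \<open>finite L\<close> by (intro sum.cong) (auto simp: L)
  also have "\<dots> = (\<Sum>B\<in>{B\<in>Pow I. v \<subseteq> ?c B}. (-1) ^ card B)"
    using assms(1) by (intro sum.inter_filter [symmetric]) simp
  also have "{B\<in>Pow I. v \<subseteq> ?c B} = Pow {i\<in>I. v \<subseteq> h i}"
    using \<open>v \<subseteq> U\<close> by blast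
  also have "(\<Sum>B\<in>\<dots>. (-1) ^ card B) = (if {i\<in>I. v \<subseteq> h i} = {} then 1 else (0::int))"
    using assms(1) by (simp add: sum_Pow_minus_one_power)
  also have "{i\<in>I. v \<subseteq> h i} = {} \<longleftrightarrow> v = U"
  proof
    assume e: "{i\<in>I. v \<subseteq> h i} = {}"
    obtain B where "B \<subseteq> I" "v = ?c B" using v L by auto
    moreover from this e have "B = {}" by blast
    ultimately show "v = U" by simp
  qed (use assms(2) in blast)
  finally show "(\<Sum>w\<in>{w\<in>L. v \<subseteq> w}. \<Sum>B\<in>Pow I. if ?c B = w then (-1) ^ card B else 0) =
      (if v = U then 1 else (0::int))" .
qed (use assms in simp)


subsection \<open>Permutations and chambers\<close>

lemma ex_bij_betw_strict_mono_on:
  fixes A :: "'a::linorder set"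
  assumes "finite A"
  shows "\<exists>g. bij_betw g {..<card A} A \<and> strict_mono_on {..<card A} g"
proof (intro exI conjI)
  show "bij_betw ((!) (sorted_list_of_set A)) {..<card A} A"
    using assms by (intro bij_betw_nth) auto
  show "strict_mono_on {..<card A} ((!) (sorted_list_of_set A))"
    using assms strict_sorted_list_of_set[of A]
    by (intro strict_mono_onI sorted_wrt_nth_less[of "(<)"]) simp_all
qed

text \<open>Ranks link indices to sorted values: \<open>\<sigma> i\<close> is the coordinate whose
  value has the same rank among all values as \<open>i\<close> has among all indices.\<close>

lemma ex_sorting_permutation:
  fixes y :: "'d::{finite,linorder} \<Rightarrow> real"
  assumes "inj y"
  shows "\<exists>\<sigma>. \<sigma> permutes UNIV \<and> strict_mono (y \<circ> \<sigma>)"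
proof -
  obtain g where g: "bij_betw g {..<CARD('d)} (UNIV :: 'd set)" "strict_mono_on {..<CARD('d)} g"
    using ex_bij_betw_strict_mono_on[of "UNIV :: 'd set"] by auto
  have "card (range y) = CARD('d)"
    using assms by (simp add: card_image)
  then obtain k where k: "bij_betw k {..<CARD('d)} (range y)" "strict_mono_on {..<CARD('d)} k"
    using ex_bij_betw_strict_mono_on[of "range y"] by auto
  \<comment> \<open>The rank of an index, counted from 0.\<close>
  define n where "n = inv_into {..<CARD('d)} g"
  have n: "bij_betw n UNIV {..<CARD('d)}"
    unfolding n_def by (rule bij_betw_inv_into[OF g(1)])
  have gn: "g (n i) = i" for i
    unfolding n_def using g(1) by (simp add: bij_betw_inv_into_right)
  have n_less: "n i < n j" if "i < j" for i j
  proof (rule ccontr)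
    assume "\<not> n i < n j"
    then have "g (n j) \<le> g (n i)"
      using n by (intro strict_mono_on_leD[OF g(2)]) (auto simp: bij_betw_def)
    then show False using gn that by simp
  qed
  have kn: "bij_betw (k \<circ> n) UNIV (range y)"
    by (rule bij_betw_trans[OF n k(1)])
  have y: "bij_betw (inv y) (range y) UNIV"
    using assms by (simp add: bij_betw_def inj_on_inv_into inj_imp_surj_inv image_inv_f_f)
  have "bij_betw (inv y \<circ> (k \<circ> n)) UNIV UNIV"
    by (rule bij_betw_trans[OF kn y])
  then have "inv y \<circ> (k \<circ> n) permutes UNIV"
    by (intro bij_imp_permutes) simp_all
  moreover have "y (inv y (k (n i))) = k (n i)" for i
    using kn by (intro f_inv_into_f) (auto simp: bij_betw_def)
  then have "strict_mono (y \<circ> (inv y \<circ> (k \<circ> n)))"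
    using n n_less by (auto simp: strict_mono_def bij_betw_def intro!: strict_mono_onD[OF k(2)])
  ultimately show ?thesis by blast
qed

text \<open>Such a map is injective, so it cannot squeeze an initial or a final segment into a
  smaller one. This makes a permutation recoverable from the order that it induces.\<close>

lemma strict_mono_finite_eq_id:
  fixes \<tau> :: "'d::{finite,linorder} \<Rightarrow> 'd"
  assumes "strict_mono \<tau>"
  shows "\<tau> = id"
proof -
  have card: "card (\<tau> ` A) = card A" for A
    using assms by (intro card_image inj_on_subset[OF strict_mono_imp_inj_on]) auto
  have "\<tau> i = i" for i
  proof (rule ccontr)
    assume "\<tau> i \<noteq> i"
    then consider "\<tau> i < i" | "i < \<tau> i" by fastforce
    then show False
    proof cases
      case 1
      have "\<tau> ` {..i} \<subseteq> {..\<tau> i}"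
        using assms by (auto simp: strict_mono_less_eq)
      then have "card {..i} \<le> card {..\<tau> i}"
        by (metis card card_mono finite)
      moreover have "{..\<tau> i} \<subset> {..i}" using 1 by auto
      ultimately show False
        using psubset_card_mono[of "{..i}" "{..\<tau> i}"] by simp
    next
      case 2
      have "\<tau> ` {i..} \<subseteq> {\<tau> i..}"
        using assms by (auto simp: strict_mono_less_eq)
      then have "card {i..} \<le> card {\<tau> i..}"
        by (metis card card_mono finite)
      moreover have "{\<tau> i..} \<subset> {i..}" using 2 by auto
      ultimately show False
        using psubset_card_mono[of "{i..}" "{\<tau> i..}"] by simp
    qed
  qed
  then show ?thesis by auto
qed

text \<open>Oriented so that a positive form at \<open>(j, k)\<close> means that coordinate
  \<open>j\<close> comes before coordinate \<open>k\<close> when the values are sorted.\<close>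

definition diff_vec :: "'d \<times> 'd \<Rightarrow> real ^ 'd::finite" where
  "diff_vec = (\<lambda>(j, k). axis k 1 - axis j 1)"

lemma inner_diff_vec [simp]: "diff_vec (j, k) \<bullet> x = x $ k - x $ j"
  by (simp add: diff_vec_def inner_diff_left inner_axis')

text \<open>Compatibility fixes the order of coordinates at which \<open>x\<close> differs, so a
  permutation is determined by how it breaks the ties of \<open>x\<close>. The realizable ways to
  break them are the chambers of the hyperplanes through \<open>x\<close>.\<close>

lemma card_compatible_realizable:
  fixes s :: "(real ^ 'd::{finite,linorder}) set"
  assumes "subspace s" "x \<in> s"
  shows "card {\<sigma>. \<sigma> permutes UNIV \<and> compatible x \<sigma> \<and> realizable_in \<sigma> s} =
    card (patterns s diff_vec {(j, k). j < k \<and> x $ j = x $ k})"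
proof -
  let ?I = "{(j, k). j < k \<and> x $ j = x $ k}"
  let ?\<Sigma> = "{\<sigma>. \<sigma> permutes UNIV \<and> compatible x \<sigma> \<and> realizable_in \<sigma> s}"
  \<comment> \<open>\<open>inv \<sigma> j\<close> is the position of \<open>j\<close> in the order,
    so \<open>q\<close> records the ties of \<open>x\<close> that are broken with the smaller index
    first.\<close>
  define q where "q = (\<lambda>\<sigma>::'d \<Rightarrow> 'd. {(j, k)\<in>?I. inv \<sigma> j < inv \<sigma> k})"
  have pat: "q \<sigma> = {i\<in>?I. 0 < diff_vec i \<bullet> y}" "\<forall>i\<in>?I. diff_vec i \<bullet> y \<noteq> 0"
    if \<sigma>: "\<sigma> permutes UNIV" and y: "realizes y \<sigma>" for \<sigma> y
  proof -
    have "y $ j < y $ k \<longleftrightarrow> inv \<sigma> j < inv \<sigma> k" for j k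
    proof -
      have "strict_mono (\<lambda>i. y $ \<sigma> i)"
        using y by (auto simp: realizes_def strict_mono_def)
      from strict_mono_less[OF this, of "inv \<sigma> j" "inv \<sigma> k"] show ?thesis
        using permutes_inverses(1)[OF \<sigma>] by simp
    qed
    then show "q \<sigma> = {i\<in>?I. 0 < diff_vec i \<bullet> y}"
      by (auto simp: q_def)
    show "\<forall>i\<in>?I. diff_vec i \<bullet> y \<noteq> 0"
      using y by (auto simp: realizes_def distinct_coords_def inj_def)
  qed
  have inj_q: "inj_on q ?\<Sigma>"
  proof (rule inj_onI)
    fix \<sigma> \<rho> assume \<sigma>: "\<sigma> \<in> ?\<Sigma>" and \<rho>: "\<rho> \<in> ?\<Sigma>" and eq: "q \<sigma> = q \<rho>"
    have perm: "\<sigma> permutes UNIV" "\<rho> permutes UNIV" using \<sigma> \<rho> by auto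
    have mono: "x $ j \<le> x $ k" if "\<pi> \<in> ?\<Sigma>" "inv \<pi> j \<le> inv \<pi> k" for \<pi> j k
    proof -
      have "x $ \<pi> (inv \<pi> j) \<le> x $ \<pi> (inv \<pi> k)"
        using that by (auto simp: compatible_def)
      then show ?thesis using that permutes_inverses(1)[of \<pi> UNIV] by simp
    qed
    have imp: "inv \<rho> j < inv \<rho> k" if less: "inv \<sigma> j < inv \<sigma> k" for j k
    proof (rule ccontr)
      assume n: "\<not> inv \<rho> j < inv \<rho> k"
      \<comment> \<open>If the two orders disagree on \<open>j\<close> and \<open>k\<close>,
        compatibility with both forces a tie, and on ties \<open>q \<sigma> = q \<rho>\<close> rules
        the disagreement out.\<close>
      have x: "x $ j = x $ k"
        using mono[OF \<sigma>, of j k] mono[OF \<rho>, of k j] less n by (simp add: order_eq_iff)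
      have "j \<noteq> k" using less by auto
      then consider "j < k" | "k < j" by fastforce
      then show False
      proof cases
        case 1
        then have "(j, k) \<in> q \<sigma>" using x less by (simp add: q_def)
        then show False using n by (simp add: eq) (simp add: q_def)
      next
        case 2
        have "inv \<rho> k \<noteq> inv \<rho> j"
          using \<open>j \<noteq> k\<close> perm(2) by (metis permutes_inverses(1))
        then have "(k, j) \<in> q \<rho>" using x n 2 by (simp add: q_def)
        then show False using less by (simp only: eq[symmetric]) (auto simp: q_def)
      qed
    qed
    have "strict_mono (\<lambda>i. inv \<rho> (\<sigma> i))"
      using imp permutes_inverses(2)[OF perm(1)] by (auto simp: strict_mono_def)
    then have "inv \<rho> (\<sigma> i) = i" for i
      by (metis strict_mono_finite_eq_id id_apply)
    then show "\<sigma> = \<rho>"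
      using permutes_inverses(1)[OF perm(2)] by (metis ext)
  qed
  have image_q: "q ` ?\<Sigma> = patterns s diff_vec ?I"
  proof
    show "q ` ?\<Sigma> \<subseteq> patterns s diff_vec ?I"
      using pat unfolding patterns_def realizable_in_def by blast
    show "patterns s diff_vec ?I \<subseteq> q ` ?\<Sigma>"
    proof
      fix T assume "T \<in> patterns s diff_vec ?I"
      then obtain z where z: "z \<in> s" "\<forall>i\<in>?I. diff_vec i \<bullet> z \<noteq> 0" and T: "T = {i\<in>?I. 0 < diff_vec i \<bullet> z}"
        unfolding patterns_def by blast
      \<comment> \<open>A small step from \<open>x\<close> along \<open>z\<close> keeps the order of
        coordinates that \<open>x\<close> separates and orders the tied ones as \<open>z\<close>
        does.\<close>
      have "\<exists>e>0. \<forall>i\<in>{(j, k). x $ j \<noteq> x $ k}. sgn (diff_vec i \<bullet> (x + e *\<^sub>R z)) = sgn (diff_vec i \<bullet> x)"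
        by (rule exists_small_perturbation) auto
      then obtain e where e: "e > 0"
        "\<And>j k. x $ j \<noteq> x $ k \<Longrightarrow> sgn (diff_vec (j, k) \<bullet> (x + e *\<^sub>R z)) = sgn (diff_vec (j, k) \<bullet> x)"
        by blast
      define y where "y = x + e *\<^sub>R z"
      have ys: "y \<in> s"
        unfolding y_def using assms z(1) by (intro subspace_add subspace_scale)
      have yz: "diff_vec i \<bullet> y = e * (diff_vec i \<bullet> z)" if "i \<in> ?I" for i
        using that by (auto simp: y_def algebra_simps)
      have yx: "y $ j \<noteq> y $ k" "y $ j < y $ k \<longleftrightarrow> x $ j < x $ k" if "x $ j \<noteq> x $ k" for j k
        using sgn_eq_imp[OF e(2)[OF that]] that unfolding y_def[symmetric] by simp_all
      have yne: "y $ j \<noteq> y $ k" if "j < k" for j k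
      proof (cases "x $ j = x $ k")
        case True
        then have jk: "(j, k) \<in> ?I" using that by simp
        then have "diff_vec (j, k) \<bullet> z \<noteq> 0" using z(2) by blast
        then show ?thesis using yz[OF jk] e(1) by auto
      qed (use yx(1) in blast)
      have inj: "inj (\<lambda>i. y $ i)"
        by (rule linorder_injI) (use yne in auto)
      then obtain \<sigma> where \<sigma>: "\<sigma> permutes UNIV" "strict_mono ((\<lambda>i. y $ i) \<circ> \<sigma>)"
        using ex_sorting_permutation by blast
      then have real: "realizes y \<sigma>"
        using inj by (auto simp: realizes_def distinct_coords_def strict_mono_def)
      have "x $ \<sigma> i \<le> x $ \<sigma> j" if "i \<le> j" for i j
      proof (cases "i = j")
        case False
        then have "y $ \<sigma> i < y $ \<sigma> j" using that real by (auto simp: realizes_def)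
        then show ?thesis using yx(2) by (metis less_le_not_le linorder_linear order_less_imp_le)
      qed simp
      then have "\<sigma> \<in> ?\<Sigma>"
        using \<sigma>(1) real ys by (auto simp: compatible_def realizable_in_def)
      moreover have "T = q \<sigma>"
        unfolding pat(1)[OF \<sigma>(1) real] T using yz e(1) by (auto simp: zero_less_mult_iff)
      ultimately show "T \<in> q ` ?\<Sigma>" by blast
    qed
  qed
  show ?thesis
    unfolding image_q[symmetric] by (rule card_image[OF inj_q, symmetric])
qed

subsection \<open>Lattice points in dilated cubes\<close>

lemma finite_integer_box:
  "finite {x \<in> integer_points :: (real ^ 'd::finite) set. \<forall>i. 0 \<le> x $ i \<and> x $ i \<le> real t}"
proof (rule finite_subset)
  show "finite ((\<lambda>g. \<chi> i. real (g i)) ` (UNIV \<rightarrow>\<^sub>E {..t}) :: (real ^ 'd) set)"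
    by (intro finite_imageI finite_PiE) auto
  show "{x \<in> integer_points. \<forall>i. 0 \<le> x $ i \<and> x $ i \<le> real t} \<subseteq>
      ((\<lambda>g. \<chi> i. real (g i)) ` (UNIV \<rightarrow>\<^sub>E {..t}) :: (real ^ 'd) set)"
  proof
    fix x :: "real ^ 'd" assume x: "x \<in> {x \<in> integer_points. \<forall>i. 0 \<le> x $ i \<and> x $ i \<le> real t}"
    have "real (nat \<lfloor>x $ i\<rfloor>) = x $ i" "nat \<lfloor>x $ i\<rfloor> \<le> t" for i
    proof -
      have "x $ i \<in> \<int>" "0 \<le> x $ i" "x $ i \<le> real t"
        using x by (auto simp: integer_points_def)
      then show "real (nat \<lfloor>x $ i\<rfloor>) = x $ i" "nat \<lfloor>x $ i\<rfloor> \<le> t"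
        by (auto elim!: Ints_cases)
    qed
    then show "x \<in> (\<lambda>g. \<chi> i. real (g i)) ` (UNIV \<rightarrow>\<^sub>E {..t})"
      by (intro image_eqI[of _ _ "\<lambda>i. nat \<lfloor>x $ i\<rfloor>"]) (auto simp: vec_eq_iff)
  qed
qed

text \<open>A dilation maps \<open>G\<close> onto itself, so only \<open>Q\<close> is
  scaled.\<close>

lemma scaled_Int_subspace:
  assumes "subspace G" "c \<noteq> 0"
  shows "(\<lambda>x. c *\<^sub>R x) ` (Q \<inter> G) = {x \<in> G. (1 / c) *\<^sub>R x \<in> Q}"
proof
  show "(\<lambda>x. c *\<^sub>R x) ` (Q \<inter> G) \<subseteq> {x \<in> G. (1 / c) *\<^sub>R x \<in> Q}"
    using assms by (auto simp: subspace_scale)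
  show "{x \<in> G. (1 / c) *\<^sub>R x \<in> Q} \<subseteq> (\<lambda>x. c *\<^sub>R x) ` (Q \<inter> G)"
  proof
    fix x assume "x \<in> {x \<in> G. (1 / c) *\<^sub>R x \<in> Q}"
    then show "x \<in> (\<lambda>x. c *\<^sub>R x) ` (Q \<inter> G)"
      using assms by (intro image_eqI[of _ _ "(1 / c) *\<^sub>R x"]) (auto simp: subspace_scale)
  qed
qed

text \<open>Double counting of the pairs of a flat and a point on it, weighted by
  \<open>w\<close>.\<close>

lemma sum_card_swap:
  fixes w :: "'u \<Rightarrow> int"
  assumes "finite L" "finite X"
  shows "(\<Sum>u\<in>L. w u * int (card {x\<in>X. x \<in> G u})) = (\<Sum>x\<in>X. \<Sum>u\<in>{u\<in>L. x \<in> G u}. w u)"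
proof -
  have "(\<Sum>u\<in>L. w u * int (card {x\<in>X. x \<in> G u})) = (\<Sum>u\<in>L. \<Sum>x\<in>X. if x \<in> G u then w u else 0)"
    using assms(2) by (simp add: sum.If_cases Int_def mult.commute)
  also have "\<dots> = (\<Sum>x\<in>X. \<Sum>u\<in>L. if x \<in> G u then w u else 0)"
    by (rule sum.swap)
  also have "\<dots> = (\<Sum>x\<in>X. \<Sum>u\<in>{u\<in>L. x \<in> G u}. w u)"
    using assms(1) by (simp add: sum.inter_filter)
  finally show ?thesis .
qed

lemma closed_cube_eq_cbox: "closed_cube = (cbox 0 (\<chi> i. 1) :: (real ^ 'd::finite) set)"
  by (auto simp: closed_cube_def mem_box_cart)

lemma open_cube_eq_box: "open_cube = (box 0 (\<chi> i. 1) :: (real ^ 'd::finite) set)"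
  by (auto simp: open_cube_def mem_box_cart)

text \<open>Since \<open>s\<close> meets the interior of the cube, taking the relative interior
  commutes with intersecting by \<open>s\<close>.\<close>

lemma rel_interior_closed_cube_Int_subspace:
  fixes s :: "(real ^ 'd::finite) set"
  assumes "subspace s" "open_cube \<inter> s \<noteq> {}"
  shows "rel_interior (closed_cube \<inter> s) = open_cube \<inter> s"
proof -
  have "interior closed_cube = (open_cube :: (real ^ 'd) set)"
    by (simp add: closed_cube_eq_cbox open_cube_eq_box)
  then have "rel_interior closed_cube = (open_cube :: (real ^ 'd) set)"
    using assms(2) rel_interior_nonempty_interior by force
  then show ?thesis
    using convex_affine_rel_interior_Int[of closed_cube s] assms subspace_imp_affine[of s]
    by (simp add: closed_cube_eq_cbox)
qed

section \<open>The arrangement induced on \<open>s\<close> and the evaluation of both sums point by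
  point\<close>

theorem theorem3p5:
  fixes f :: "nat \<Rightarrow> real ^ 'd::{finite,linorder} \<Rightarrow> real"
    and m t :: nat
    and s P :: "(real ^ 'd::{finite,linorder}) set"
    and \<H> L :: "(real ^ 'd::{finite,linorder}) set set"
  assumes "\<And>i. i \<in> {1..m} \<Longrightarrow> rational_linear_form (f i)"
    and "\<And>i. i \<in> {1..m} \<Longrightarrow> weight_zero (f i)"
    and "s = {x. \<forall>i\<in>{1..m}. f i x = 0}"
    and "P = closed_cube \<inter> s"
    and "\<H> = induced_arrangement s"
    and "L = intersection_poset (rel_interior P) \<H>"
    and "\<exists>x \<in> s \<inter> integer_points. distinct_coords x \<and> (\<forall>i. 0 < x $ i)"
    and "0 < t"
  shows "int (open_count s t) =
           (\<Sum>u\<in>L. moebius_fun L (rel_interior P) u * int (flat_ehrhart open_cube u t))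
       \<and> int (closed_count s t) =
           (\<Sum>u\<in>L. \<bar>moebius_fun L (rel_interior P) u\<bar> * int (flat_ehrhart closed_cube u t))"
proof -
  define I :: "('d \<times> 'd) set" where "I = {(j, k). j < k}"
  define h :: "'d \<times> 'd \<Rightarrow> ((real, 'd) vec) set" where "h = (\<lambda>(j, k). hyp j k)"
  define U where "U = open_cube \<inter> s"
  define F where "F = flat s diff_vec"
  have finI: "finite I" by simp
  have s: "subspace s"
    using assms(1) unfolding assms(3) rational_linear_form_def
    by (auto simp: subspace_def linear_0 linear_add linear_cmul)
  \<comment> \<open>The centre of the cube. Weight zero puts it in \<open>s\<close>, and its equal
    coordinates put it on every hyperplane, so it lies in every cell.\<close>
  define c :: "(real, 'd) vec" where "c = (1 / 2) *\<^sub>R (\<chi> i. 1)"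
  have cs: "c \<in> s"
    using assms(1,2) unfolding c_def
    by (intro subspace_scale[OF s]) (simp add: assms(3) weight_zero_def)
  have c_cube: "c \<in> open_cube"
    by (simp add: c_def open_cube_def)
  have relint: "rel_interior P = U"
    unfolding assms(4) U_def using cs c_cube
    by (intro rel_interior_closed_cube_Int_subspace[OF s]) auto
  have F_eq: "F B = s \<inter> (\<Inter>i\<in>B. h i)" for B
    by (fastforce simp: F_def flat_def h_def hyp_def)
  have cF: "c \<in> F B" for B
    using cs by (auto simp: F_def flat_def c_def)
  have cell: "U \<inter> (\<Inter>i\<in>B. h i) = F B \<inter> open_cube" for B
    by (auto simp: U_def F_eq)
  have subF: "subspace (F B)" for B
    unfolding F_def by (rule subspace_flat[OF s])
  \<comment> \<open>The cell is nonempty and relatively open in \<open>F B\<close>, hence spans it.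
    Cells and flats therefore determine each other.\<close>
  have hull: "affine hull (F B \<inter> open_cube) = F B" for B
  proof -
    have "affine (F B)" by (rule subspace_imp_affine[OF subF])
    moreover have "open (open_cube :: (real, 'd) vec set)" by (simp add: open_cube_eq_box open_box)
    moreover have "F B \<inter> open_cube \<noteq> {}" using cF c_cube by blast
    ultimately show ?thesis
      by (metis affine_hull_affine_Int_open affine_hull_eq)
  qed
  \<comment> \<open>The magic labelling avoids every hyperplane, so each pair \<open>j < k\<close>
    contributes to the induced arrangement.\<close>
  have not_sub: "\<not> s \<subseteq> h i" if "i \<in> I" for i
  proof -
    obtain x where "x \<in> s" "distinct_coords x" using assms(7) by blast
    then show ?thesis
      using that by (auto simp: I_def h_def hyp_def distinct_coords_def inj_def)
  qed
  have not_subU: "\<not> U \<subseteq> h i" if "i \<in> I" for i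
  proof
    assume "U \<subseteq> h i"
    then have "F {i} \<inter> open_cube = F {} \<inter> open_cube"
      by (auto simp: U_def F_eq)
    then have "F {i} = F {}" by (metis hull)
    then show False using not_sub[OF that] by (auto simp: F_eq)
  qed
  have H: "\<H> = (\<lambda>i. h i \<inter> s) ` I"
  proof -
    have "\<H> = {h (j, k) \<inter> s | j k. (j, k) \<in> I \<and> \<not> s \<subseteq> h (j, k)}"
      by (simp add: assms(5) induced_arrangement_def I_def h_def)
    also have "\<dots> = (\<lambda>i. h i \<inter> s) ` I"
      using not_sub by (auto, blast)
    finally show ?thesis .
  qed
  \<comment> \<open>Different pairs may induce the same hyperplane of \<open>s\<close>; sets of
    pairs replace subsets of \<open>\<H>\<close>, which Whitney's formula permits. Discarding the
    empty set changes nothing, as every cell contains \<open>c\<close>.\<close>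
  have L: "L = (\<lambda>B. U \<inter> (\<Inter>i\<in>B. h i)) ` Pow I"
  proof -
    have "{U \<inter> \<Inter>\<S> | \<S>. \<S> \<subseteq> \<H>} = (\<lambda>B. U \<inter> \<Inter>((\<lambda>i. h i \<inter> s) ` B)) ` Pow I"
    proof -
      have "{U \<inter> \<Inter>\<S> | \<S>. \<S> \<subseteq> \<H>} = (\<lambda>\<S>. U \<inter> \<Inter>\<S>) ` Pow \<H>"
        by blast
      moreover have "Pow \<H> = (`) (\<lambda>i. h i \<inter> s) ` Pow I"
        unfolding H by (simp add: image_Pow_surj)
      ultimately show ?thesis by (simp only: image_image)
    qed
    also have "\<dots> = (\<lambda>B. U \<inter> (\<Inter>i\<in>B. h i)) ` Pow I"
      by (intro image_cong) (auto simp: U_def)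
    finally have sets: "{U \<inter> \<Inter>\<S> | \<S>. \<S> \<subseteq> \<H>} = (\<lambda>B. U \<inter> (\<Inter>i\<in>B. h i)) ` Pow I" .
    show ?thesis
    proof -
      have "U \<inter> (\<Inter>i\<in>B. h i) \<noteq> {}" for B
        using cF c_cube unfolding cell by blast
      then show "L = (\<lambda>B. U \<inter> (\<Inter>i\<in>B. h i)) ` Pow I"
        unfolding assms(6) intersection_poset_def relint sets by blast
    qed
  qed
  have L': "L = (\<lambda>B. F B \<inter> open_cube) ` Pow I"
    unfolding L cell ..
  have hullL: "F B \<inter> open_cube = v \<longleftrightarrow> F B = affine hull v" if v: "v \<in> L" for v B
  proof -
    obtain C where C: "v = F C \<inter> open_cube" using v unfolding L' by blast
    then have "affine hull v = F C" by (simp only: hull)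
    then show ?thesis using C hull[of B] by metis
  qed
  have finL: "finite L" using finI by (simp add: L)
  have mu: "moebius_fun L U v = (\<Sum>B\<in>Pow I. if F B = affine hull v then (-1) ^ card B else 0)"
    if "v \<in> L" for v
  proof -
    show ?thesis
      using moebius_fun_Whitney[OF finI not_subU L that] hullL[OF that] unfolding cell by simp
  qed
  have abs_mu: "\<bar>moebius_fun L U v\<bar> =
      (\<Sum>B\<in>Pow I. if F B = affine hull v then (-1) ^ (card B + dim s + dim (F B)) else 0)"
    if "v \<in> L" for v
  proof -
    have abs_minus_one_power: "\<bar>(-1::int) ^ n\<bar> = 1" for n by (simp add: power_abs)
    \<comment> \<open>The parity of the codimension of the flat. The product with this sign is
      nonnegative, hence it is the absolute value.\<close>
    let ?e = "(-1::int) ^ (dim s + dim (affine hull v))"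
    have "0 \<le> ?e * moebius_fun L U v"
      unfolding mu[OF that] F_def by (rule Whitney_sum_sign[OF finI s])
    then have "\<bar>moebius_fun L U v\<bar> = ?e * moebius_fun L U v"
      by (metis abs_mult abs_of_nonneg abs_minus_one_power mult_1)
    also have "\<dots> = (\<Sum>B\<in>Pow I. if F B = affine hull v then (-1) ^ (card B + dim s + dim (F B)) else 0)"
      unfolding mu[OF that] sum_distrib_left
      by (intro sum.cong) (auto simp: power_add)
    finally show ?thesis .
  qed
  \<comment> \<open>Each \<open>B\<close> cuts out exactly one flat, so the flats through
    \<open>x\<close> together collect every \<open>B\<close> with \<open>x\<close> in
    \<open>F B\<close>. These are the sets of pairs tied in \<open>x\<close>.\<close>
  have point: "(\<Sum>u\<in>{u\<in>L. x \<in> affine hull u}. \<Sum>B\<in>Pow I. if F B = affine hull u then g B else 0) =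
      (\<Sum>B\<in>Pow {(j, k). j < k \<and> x $ j = x $ k}. g B)" if x: "x \<in> s" for x and g :: "('d \<times> 'd) set \<Rightarrow> int"
  proof -
    have "(\<Sum>u\<in>{u\<in>L. x \<in> affine hull u}. \<Sum>B\<in>Pow I. if F B = affine hull u then g B else 0) =
        (\<Sum>u\<in>{u\<in>L. x \<in> affine hull u}. \<Sum>B\<in>Pow I. if F B \<inter> open_cube = u then g B else 0)"
      using hullL by (intro sum.cong) auto
    also have "\<dots> = (\<Sum>B\<in>Pow I. \<Sum>u\<in>{u\<in>L. x \<in> affine hull u}. if F B \<inter> open_cube = u then g B else 0)"
      by (rule sum.swap)
    also have "\<dots> = (\<Sum>B\<in>Pow I. if x \<in> F B then g B else 0)"
      using finL hull by (intro sum.cong) (simp_all add: L')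
    also have "\<dots> = (\<Sum>B\<in>{B\<in>Pow I. x \<in> F B}. g B)"
      using finI by (intro sum.inter_filter[symmetric]) simp
    also have "{B\<in>Pow I. x \<in> F B} = Pow {(j, k). j < k \<and> x $ j = x $ k}"
      using x by (fastforce simp: F_def flat_def I_def)
    finally show ?thesis .
  qed
  define X where "X = {x \<in> s \<inter> integer_points. \<forall>i. 0 < x $ i \<and> x $ i < real t}"
  define Y where "Y = {x \<in> s \<inter> integer_points. \<forall>i. 0 \<le> x $ i \<and> x $ i \<le> real t}"
  have finY: "finite Y"
    by (rule finite_subset[OF _ finite_integer_box[of t]]) (auto simp: Y_def)
  have finX: "finite X"
    by (rule finite_subset[OF _ finY]) (auto simp: X_def Y_def less_imp_le)
  have E: "flat_ehrhart open_cube u t = card {x\<in>X. x \<in> affine hull u}"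
    "flat_ehrhart closed_cube u t = card {x\<in>Y. x \<in> affine hull u}" if u: "u \<in> L" for u
  proof -
    obtain B where B: "affine hull u = F B" using u hull unfolding L' by blast
    have "integer_points \<inter> (\<lambda>x. real t *\<^sub>R x) ` (open_cube \<inter> F B) = {x\<in>X. x \<in> F B}"
      using assms(8) by (subst scaled_Int_subspace[OF subF])
        (auto simp: X_def open_cube_def F_def flat_def divide_less_eq zero_less_divide_iff)
    then show "flat_ehrhart open_cube u t = card {x\<in>X. x \<in> affine hull u}"
      by (simp add: flat_ehrhart_def ehrhart_def B)
    have "integer_points \<inter> (\<lambda>x. real t *\<^sub>R x) ` (closed_cube \<inter> F B) = {x\<in>Y. x \<in> F B}"
      using assms(8) by (subst scaled_Int_subspace[OF subF])
        (auto simp: Y_def closed_cube_def F_def flat_def divide_le_eq zero_le_divide_iff)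
    then show "flat_ehrhart closed_cube u t = card {x\<in>Y. x \<in> affine hull u}"
      by (simp add: flat_ehrhart_def ehrhart_def B)
  qed
  have "(\<Sum>u\<in>L. moebius_fun L U u * int (flat_ehrhart open_cube u t)) =
      (\<Sum>x\<in>X. \<Sum>u\<in>{u\<in>L. x \<in> affine hull u}. moebius_fun L U u)"
    using sum_card_swap[OF finL finX, of "moebius_fun L U" "\<lambda>u. affine hull u"] by (simp add: E)
  also have "\<dots> = (\<Sum>x\<in>X. \<Sum>B\<in>Pow {(j, k). j < k \<and> x $ j = x $ k}. (-1) ^ card B)"
  proof (rule sum.cong)
    fix x assume "x \<in> X"
    then have "x \<in> s" by (simp add: X_def)
    from point[OF this, of "\<lambda>B. (-1) ^ card B"] show
      "(\<Sum>u\<in>{u\<in>L. x \<in> affine hull u}. moebius_fun L U u) =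
        (\<Sum>B\<in>Pow {(j, k). j < k \<and> x $ j = x $ k}. (-1) ^ card B)"
      by (simp add: mu)
  qed simp
  also have "\<dots> = (\<Sum>x\<in>X. if distinct_coords x then 1 else 0)"
  proof (rule sum.cong)
    fix x assume "x \<in> X"
    have "{(j, k). j < k \<and> x $ j = x $ k} = {} \<longleftrightarrow> distinct_coords x"
      unfolding distinct_coords_def
      by (auto simp: inj_def) (metis linorder_less_linear)
    then show "(\<Sum>B\<in>Pow {(j, k). j < k \<and> x $ j = x $ k}. (-1::int) ^ card B) =
        (if distinct_coords x then 1 else 0)"
      by (simp add: sum_Pow_minus_one_power)
  qed simp
  also have "\<dots> = int (card {x\<in>X. distinct_coords x})"
    using finX by (simp add: sum.If_cases Int_def)
  also have "{x\<in>X. distinct_coords x} =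
      {x \<in> s \<inter> integer_points. distinct_coords x \<and> (\<forall>i. 0 < x $ i \<and> x $ i < real t)}"
    by (auto simp: X_def)
  finally have "open": "int (open_count s t) =
      (\<Sum>u\<in>L. moebius_fun L U u * int (flat_ehrhart open_cube u t))"
    by (simp add: open_count_def)
  have "(\<Sum>u\<in>L. \<bar>moebius_fun L U u\<bar> * int (flat_ehrhart closed_cube u t)) =
      (\<Sum>x\<in>Y. \<Sum>u\<in>{u\<in>L. x \<in> affine hull u}. \<bar>moebius_fun L U u\<bar>)"
    using sum_card_swap[OF finL finY, of "\<lambda>u. \<bar>moebius_fun L U u\<bar>" "\<lambda>u. affine hull u"] by (simp add: E)
  also have "\<dots> = (\<Sum>x\<in>Y. int (card {\<sigma>. \<sigma> permutes UNIV \<and> compatible x \<sigma> \<and> realizable_in \<sigma> s}))"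
  proof (rule sum.cong)
    fix x assume "x \<in> Y"
    then have x: "x \<in> s" by (simp add: Y_def)
    let ?I = "{(j, k). j < k \<and> x $ j = x $ k}"
    have "(\<Sum>u\<in>{u\<in>L. x \<in> affine hull u}. \<bar>moebius_fun L U u\<bar>) =
        (\<Sum>B\<in>Pow ?I. (-1) ^ (card B + dim s + dim (F B)))"
      using point[OF x, of "\<lambda>B. (-1) ^ (card B + dim s + dim (F B))"] by (simp add: abs_mu)
    \<comment> \<open>Zaslavsky's theorem for the hyperplanes through \<open>x\<close>; its signs
      are those that turn \<open>\<mu>\<close> into its absolute value.\<close>
    also have "\<dots> = int (card (patterns s diff_vec ?I))"
      unfolding F_def by (rule card_patterns[symmetric]) (simp_all add: s)
    also have "\<dots> = int (card {\<sigma>. \<sigma> permutes UNIV \<and> compatible x \<sigma> \<and> realizable_in \<sigma> s})"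
      by (simp only: card_compatible_realizable[OF s x])
    finally show "(\<Sum>u\<in>{u\<in>L. x \<in> affine hull u}. \<bar>moebius_fun L U u\<bar>) =
        int (card {\<sigma>. \<sigma> permutes UNIV \<and> compatible x \<sigma> \<and> realizable_in \<sigma> s})" .
  qed simp
  also have "\<dots> = int (card (SIGMA x:Y. {\<sigma>. \<sigma> permutes UNIV \<and> compatible x \<sigma> \<and> realizable_in \<sigma> s}))"
    using finY by (simp add: card_SigmaI)
  also have "(SIGMA x:Y. {\<sigma>. \<sigma> permutes UNIV \<and> compatible x \<sigma> \<and> realizable_in \<sigma> s}) =
      {(x, \<sigma>). x \<in> s \<inter> integer_points \<and> (\<forall>i. 0 \<le> x $ i \<and> x $ i \<le> real t) \<and>
        \<sigma> permutes UNIV \<and> compatible x \<sigma> \<and> realizable_in \<sigma> s}"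
    by (auto simp: Y_def)
  finally show ?thesis
    using "open" by (simp add: relint closed_count_def)
qed

end
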